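(* Let $R$ be an associative ring with identity and let $M$ be a right $R$-module. The following are equivalent: (1) $M$ is strongly ss-injective. (2) For every right $R$-module $N$ and every small submodule $A$ of $N$, every $R$-homomorphism $\alpha:A\to M$ such that $\alpha(A)$ is a semisimple submodule of $M$ extends to an $R$-homomorphism $N\to M$.
   Context: All modules are unitary. A submodule $A$ of a module $N$ is small if $A+L\neq N$ for every proper submodule $L$ of $N$. A right $R$-module $M$ is strongly ss-injective if for every right $R$-module $N$ and every semisimple small submodule $K$ of $N$, every $R$-homomorphism $K\to M$ extends to an $R$-homomorphism $N\to M$. *)

theory Defs
  imports "HOL-Algebra.Algebra"
begin

text \<open>
  The library locale \<^locale>\<open>module\<close> requires a commutative ring of scalars, so unitary right
  modules over an arbitrary ring are introduced here, on the same record type.  The scalar comes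
  first in the record field: \<open>a \<odot>\<^bsub>M\<^esub> x\<close> stands for the right action \<open>x a\<close>, which is
  why the associativity law \<open>x (a b) = (x a) b\<close> looks reversed.
\<close>

locale right_module = R?: ring R + M?: abelian_group M
  for R :: "('a, 'r) ring_scheme" (structure)
    and M :: "('a, 'b, 'm) module_scheme" (structure) +
  assumes smult_closed:
      "\<lbrakk> a \<in> carrier R; x \<in> carrier M \<rbrakk> \<Longrightarrow> a \<odot>\<^bsub>M\<^esub> x \<in> carrier M"
    and smult_l_distr:
      "\<lbrakk> a \<in> carrier R; b \<in> carrier R; x \<in> carrier M \<rbrakk> \<Longrightarrow>
      (a \<oplus> b) \<odot>\<^bsub>M\<^esub> x = a \<odot>\<^bsub>M\<^esub> x \<oplus>\<^bsub>M\<^esub> b \<odot>\<^bsub>M\<^esub> x"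
    and smult_r_distr:
      "\<lbrakk> a \<in> carrier R; x \<in> carrier M; y \<in> carrier M \<rbrakk> \<Longrightarrow>
      a \<odot>\<^bsub>M\<^esub> (x \<oplus>\<^bsub>M\<^esub> y) = a \<odot>\<^bsub>M\<^esub> x \<oplus>\<^bsub>M\<^esub> a \<odot>\<^bsub>M\<^esub> y"
    and smult_assoc:
      "\<lbrakk> a \<in> carrier R; b \<in> carrier R; x \<in> carrier M \<rbrakk> \<Longrightarrow>
      (a \<otimes> b) \<odot>\<^bsub>M\<^esub> x = b \<odot>\<^bsub>M\<^esub> (a \<odot>\<^bsub>M\<^esub> x)"
    and smult_one:
      "x \<in> carrier M \<Longrightarrow> \<one> \<odot>\<^bsub>M\<^esub> x = x"

text \<open>
  The library locale \<^locale>\<open>submodule\<close> (a subgroup closed under the scalar action) does not involve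
  the associativity law and is used as it is.  A submodule \<open>K\<close> of \<open>N\<close>, regarded as a module in its
  own right, is \<open>N\<lparr>carrier := K\<rparr>\<close>.
\<close>

definition right_module_hom ::
    "('a, 'r) ring_scheme \<Rightarrow> ('a, 'b, 'm) module_scheme \<Rightarrow> ('a, 'c, 'n) module_scheme
      \<Rightarrow> ('b \<Rightarrow> 'c) set" where
  "right_module_hom R M N =
    {f \<in> hom (add_monoid M) (add_monoid N).
      \<forall>a \<in> carrier R. \<forall>x \<in> carrier M. f (a \<odot>\<^bsub>M\<^esub> x) = a \<odot>\<^bsub>N\<^esub> f x}"

definition small_submodule ::
    "'b set \<Rightarrow> ('a, 'r) ring_scheme \<Rightarrow> ('a, 'b, 'm) module_scheme \<Rightarrow> bool" where
  "small_submodule A R N \<longleftrightarrow> submodule A R N \<and>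
    (\<forall>L. submodule L R N \<and> L \<noteq> carrier N \<longrightarrow> A <+>\<^bsub>N\<^esub> L \<noteq> carrier N)"

definition simple_submodule ::
    "'b set \<Rightarrow> ('a, 'r) ring_scheme \<Rightarrow> ('a, 'b, 'm) module_scheme \<Rightarrow> bool" where
  "simple_submodule S R N \<longleftrightarrow> submodule S R N \<and> S \<noteq> {\<zero>\<^bsub>N\<^esub>} \<and>
    (\<forall>L. submodule L R N \<and> L \<subseteq> S \<longrightarrow> L = {\<zero>\<^bsub>N\<^esub>} \<or> L = S)"

text \<open>
  A module is semisimple if it is the sum of its simple submodules; the zero module is semisimple.
  The sum of a family of submodules is the additive subgroup generated by their union.
\<close>

definition semisimple_module ::
    "('a, 'r) ring_scheme \<Rightarrow> ('a, 'b, 'm) module_scheme \<Rightarrow> bool" where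
  "semisimple_module R N \<longleftrightarrow>
    carrier N = generate (add_monoid N) (\<Union>{S. simple_submodule S R N})"

definition semisimple_submodule ::
    "'b set \<Rightarrow> ('a, 'r) ring_scheme \<Rightarrow> ('a, 'b, 'm) module_scheme \<Rightarrow> bool" where
  "semisimple_submodule K R N \<longleftrightarrow> submodule K R N \<and> semisimple_module R (N\<lparr>carrier := K\<rparr>)"

definition extends_to_hom ::
    "('a, 'r) ring_scheme \<Rightarrow> ('a, 'b, 'm) module_scheme \<Rightarrow> ('a, 'c, 'n) module_scheme
      \<Rightarrow> 'b set \<Rightarrow> ('b \<Rightarrow> 'c) \<Rightarrow> bool" where
  "extends_to_hom R N M A f \<longleftrightarrow> (\<exists>g \<in> right_module_hom R N M. \<forall>x \<in> A. g x = f x)"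

text \<open>
  HOL cannot quantify over types inside a formula.  The type argument \<open>'c\<close> is the universe
  in which the elements of the test modules \<open>N\<close> live: \<open>N\<close> ranges over all right modules whose
  carrier is a subset of \<open>'c\<close>.  Results stated for a type variable \<open>'c\<close> hold for every universe.
\<close>

definition strongly_ss_injective ::
    "'c itself \<Rightarrow> ('a, 'r) ring_scheme \<Rightarrow> ('a, 'b, 'm) module_scheme \<Rightarrow> bool" where
  "strongly_ss_injective (_ :: 'c itself) R M \<longleftrightarrow>
    (\<forall>(N :: ('a, 'c) module) K f.
      right_module R N \<and> small_submodule K R N \<and> semisimple_submodule K R N \<and>
      f \<in> right_module_hom R (N\<lparr>carrier := K\<rparr>) M
      \<longrightarrow> extends_to_hom R N M K f)"

end

theory Submission
  imports Defs
begin

text \<open>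
  The extension property for semisimple images gives strong ss-injectivity because a homomorphic
  image of a semisimple module is semisimple (\<open>semisimple_submodule_image\<close>): a
  homomorphism from a semisimple small submodule is a homomorphism from a small submodule with
  semisimple image.

  Conversely, let \<open>\<alpha>\<close> map the small submodule \<open>A\<close> of
  \<open>N\<close> to \<open>M\<close> with semisimple image, and let \<open>K\<close> be its
  kernel. In \<open>N / K\<close> the submodule \<open>A / K\<close> is small, as the image of a
  small submodule under a surjection (\<open>small_submodule_image\<close>), and semisimple, being
  isomorphic to \<open>\<alpha>(A)\<close> (\<open>semisimple_module_if_inj_image\<close>). By
  strong ss-injectivity the injection \<open>A / K \<rightarrow> M\<close> induced by
  \<open>\<alpha>\<close> extends to \<open>N / K\<close>, and composing the extension with the
  projection \<open>N \<rightarrow> N / K\<close> extends \<open>\<alpha>\<close>.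

  The one delicate point is the universe of test modules. Strong ss-injectivity is assumed only
  for modules with elements in the type \<open>'c\<close>, whereas the elements of
  \<open>N / K\<close> are sets of such elements. The factor module is therefore carried by a set of coset
  representatives inside \<open>N\<close> (\<open>coset_rep_hom\<close>).
\<close>

section \<open>Submodules and homomorphisms of right modules\<close>

context right_module
begin

lemma zero_smult: "x \<in> carrier M \<Longrightarrow> \<zero> \<odot>\<^bsub>M\<^esub> x = \<zero>\<^bsub>M\<^esub>"
  using smult_l_distr[of \<zero> \<zero> x] smult_closed[of \<zero> x] M.add.l_cancel_one' by auto

lemma smult_zero: "a \<in> carrier R \<Longrightarrow> a \<odot>\<^bsub>M\<^esub> \<zero>\<^bsub>M\<^esub> = \<zero>\<^bsub>M\<^esub>"
  using smult_r_distr[of a "\<zero>\<^bsub>M\<^esub>" "\<zero>\<^bsub>M\<^esub>"] smult_closed[of a "\<zero>\<^bsub>M\<^esub>"]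
    M.add.l_cancel_one' by auto

lemma minus_eq_smult:
  assumes x: "x \<in> carrier M" shows "\<ominus>\<^bsub>M\<^esub> x = (\<ominus> \<one>) \<odot>\<^bsub>M\<^esub> x"
proof -
  have "(\<ominus> \<one>) \<odot>\<^bsub>M\<^esub> x \<oplus>\<^bsub>M\<^esub> x = \<zero>\<^bsub>M\<^esub>"
    using smult_l_distr[of "\<ominus> \<one>" \<one> x] x by (simp add: smult_one zero_smult R.l_neg)
  then show ?thesis using x by (simp add: M.minus_equality smult_closed)
qed

text \<open>
  Negation is the action of \<open>\<ominus> \<one>\<close>, so closure under negation follows from closure under scalars.
\<close>

lemma submodule_iff:
  "submodule H R M \<longleftrightarrow> H \<subseteq> carrier M \<and> \<zero>\<^bsub>M\<^esub> \<in> H \<and>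
    (\<forall>x\<in>H. \<forall>y\<in>H. x \<oplus>\<^bsub>M\<^esub> y \<in> H) \<and> (\<forall>a\<in>carrier R. \<forall>x\<in>H. a \<odot>\<^bsub>M\<^esub> x \<in> H)"
  (is "_ \<longleftrightarrow> ?closed")
proof
  assume "submodule H R M"
  then interpret submodule H R M .
  show ?closed using subset m_closed one_closed smult_closed by auto
next
  assume closed: ?closed
  have "inv\<^bsub>add_monoid M\<^esub> x \<in> H" if "x \<in> H" for x
  proof -
    have "\<ominus>\<^bsub>M\<^esub> x \<in> H"
      using closed that minus_eq_smult by (metis R.add.inv_closed R.one_closed subsetD)
    then show ?thesis by (simp add: a_inv_def)
  qed
  then show "submodule H R M"
    using closed by (auto intro!: submodule.intro subgroup.intro submodule_axioms.intro)
qed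

lemma submodule_is_right_module:
  assumes "submodule H R M"
  shows "right_module R (M\<lparr>carrier := H\<rparr>)"
proof -
  have H: "H \<subseteq> carrier M" using assms by (simp add: submodule_iff)
  have "abelian_group (M\<lparr>carrier := H\<rparr>)"
  proof (rule abelian_groupI)
    fix x assume "x \<in> carrier (M\<lparr>carrier := H\<rparr>)"
    then have "(\<ominus> \<one>) \<odot>\<^bsub>M\<^esub> x \<in> H" "(\<ominus> \<one>) \<odot>\<^bsub>M\<^esub> x \<oplus>\<^bsub>M\<^esub> x = \<zero>\<^bsub>M\<^esub>"
      using assms H minus_eq_smult[of x] M.l_neg[of x] by (auto simp: submodule_iff)
    then show "\<exists>y\<in>carrier (M\<lparr>carrier := H\<rparr>).
        y \<oplus>\<^bsub>M\<lparr>carrier := H\<rparr>\<^esub> x = \<zero>\<^bsub>M\<lparr>carrier := H\<rparr>\<^esub>" by auto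
  qed (use assms subsetD[OF H] in \<open>auto simp: submodule_iff M.a_assoc intro: M.a_comm\<close>)
  moreover have "right_module_axioms R (M\<lparr>carrier := H\<rparr>)"
    using assms subsetD[OF H]
    by (auto simp: right_module_axioms_def submodule_iff smult_l_distr smult_r_distr
        smult_assoc smult_one)
  ultimately show ?thesis by (simp add: right_module_def R.ring_axioms)
qed

lemma submodule_of_submodule_iff:
  assumes "submodule H R M"
  shows "submodule L R (M\<lparr>carrier := H\<rparr>) \<longleftrightarrow> submodule L R M \<and> L \<subseteq> H"
  using assms
  by (auto simp: submodule_iff right_module.submodule_iff[OF submodule_is_right_module])

lemma zero_is_submodule: "submodule {\<zero>\<^bsub>M\<^esub>} R M"
  by (simp add: submodule_iff smult_zero)

lemma carrier_is_submodule: "submodule (carrier M) R M"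
  by (simp add: submodule_iff smult_closed)

end

locale right_module_homomorphism = M: right_module R M + N: right_module R N
  for R :: "('a, 'r) ring_scheme" and M :: "('a, 'b, 'm) module_scheme"
    and N :: "('a, 'c, 'n) module_scheme" +
  fixes f :: "'b \<Rightarrow> 'c"
  assumes hom: "f \<in> right_module_hom R M N"
begin

lemma closed: "x \<in> carrier M \<Longrightarrow> f x \<in> carrier N"
  and add: "x \<in> carrier M \<Longrightarrow> y \<in> carrier M \<Longrightarrow> f (x \<oplus>\<^bsub>M\<^esub> y) = f x \<oplus>\<^bsub>N\<^esub> f y"
  and smult: "a \<in> carrier R \<Longrightarrow> x \<in> carrier M \<Longrightarrow> f (a \<odot>\<^bsub>M\<^esub> x) = a \<odot>\<^bsub>N\<^esub> f x"
  using hom by (auto simp: right_module_hom_def hom_def)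

lemma group_hom: "group_hom (add_monoid M) (add_monoid N) f"
  using hom M.M.a_group N.M.a_group
  by (simp add: group_hom_def group_hom_axioms_def right_module_hom_def)

lemma zero: "f \<zero>\<^bsub>M\<^esub> = \<zero>\<^bsub>N\<^esub>"
  using group_hom.hom_one[OF group_hom] by simp

lemma submodule_image:
  assumes "submodule H R M" shows "submodule (f ` H) R N"
proof -
  have sub: "x \<in> carrier M" if "x \<in> H" for x using assms that by (auto simp: M.submodule_iff)
  have "f x \<oplus>\<^bsub>N\<^esub> f y \<in> f ` H" if "x \<in> H" "y \<in> H" for x y
    using assms that add[of x y] sub by (metis M.submodule_iff imageI)
  moreover have "a \<odot>\<^bsub>N\<^esub> f x \<in> f ` H" if "a \<in> carrier R" "x \<in> H" for a x
    using assms that smult[of a x] sub by (metis M.submodule_iff imageI)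
  moreover have "\<zero>\<^bsub>N\<^esub> \<in> f ` H" using assms zero by (metis M.submodule_iff imageI)
  ultimately show ?thesis using sub closed by (auto simp: N.submodule_iff)
qed

lemma submodule_vimage:
  assumes "submodule H R M" "submodule L R N" shows "submodule {x \<in> H. f x \<in> L} R M"
  using assms zero by (auto simp: M.submodule_iff N.submodule_iff add smult subset_iff)

lemma restrict:
  assumes "submodule H R M" "submodule L R N" "f ` H \<subseteq> L"
  shows "right_module_homomorphism R (M\<lparr>carrier := H\<rparr>) (N\<lparr>carrier := L\<rparr>) f"
proof -
  have "f \<in> right_module_hom R (M\<lparr>carrier := H\<rparr>) (N\<lparr>carrier := L\<rparr>)"
    using assms
    by (auto simp: right_module_hom_def hom_def add smult M.submodule_iff subset_iff)
  then show ?thesis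
    using assms
    by (simp add: right_module_homomorphism_def right_module_homomorphism_axioms_def
        M.submodule_is_right_module N.submodule_is_right_module)
qed

section \<open>Homomorphic images of semisimple modules\<close>

text \<open>
  A submodule of \<open>f ` S\<close> is the image of its preimage in \<open>S\<close>, and that preimage is trivial or
  all of \<open>S\<close> when \<open>S\<close> is simple.
\<close>

lemma simple_submodule_image:
  assumes "simple_submodule S R M"
  shows "f ` S = {\<zero>\<^bsub>N\<^esub>} \<or> simple_submodule (f ` S) R N"
proof -
  have S: "submodule S R M" using assms by (simp add: simple_submodule_def)
  have "L = {\<zero>\<^bsub>N\<^esub>} \<or> L = f ` S" if L: "submodule L R N" "L \<subseteq> f ` S" for L
  proof -
    let ?P = "{x \<in> S. f x \<in> L}"
    have img: "L = f ` ?P" using L by auto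
    have "?P = {\<zero>\<^bsub>M\<^esub>} \<or> ?P = S"
      using assms submodule_vimage[OF S L(1)] by (auto simp: simple_submodule_def)
    then show ?thesis
    proof
      assume "?P = {\<zero>\<^bsub>M\<^esub>}" then show ?thesis using img zero by auto
    next
      assume "?P = S" then show ?thesis using img by auto
    qed
  qed
  then show ?thesis using submodule_image[OF S] by (auto simp: simple_submodule_def)
qed

lemma semisimple_module_image:
  assumes surj: "f ` carrier M = carrier N" and ss: "semisimple_module R M"
  shows "semisimple_module R N"
proof -
  interpret G: group_hom "add_monoid M" "add_monoid N" f by (rule group_hom)
  let ?SM = "\<Union>{S. simple_submodule S R M}" and ?SN = "\<Union>{S. simple_submodule S R N}"
  let ?gen = "generate (add_monoid N) ?SN"
  have "?SM \<subseteq> carrier M" "?SN \<subseteq> carrier N"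
    by (auto simp: simple_submodule_def M.submodule_iff N.submodule_iff)
  have "f ` ?SM \<subseteq> ?gen"
  proof
    fix y assume "y \<in> f ` ?SM"
    then obtain S where S: "simple_submodule S R M" "y \<in> f ` S" by auto
    from simple_submodule_image[OF S(1)] show "y \<in> ?gen"
    proof
      assume "f ` S = {\<zero>\<^bsub>N\<^esub>}"
      then show ?thesis using S(2) generate.one[of "add_monoid N" ?SN] by auto
    next
      assume "simple_submodule (f ` S) R N"
      then have "y \<in> ?SN" using S(2) by blast
      then show ?thesis by (rule generate.incl)
    qed
  qed
  moreover have "subgroup ?gen (add_monoid N)"
    using \<open>?SN \<subseteq> carrier N\<close> group.generate_is_subgroup[OF N.M.a_group] by simp
  ultimately have "generate (add_monoid N) (f ` ?SM) \<subseteq> ?gen"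
    by (rule group.generate_subgroup_incl[OF N.M.a_group])
  moreover have "generate (add_monoid N) (f ` ?SM) = carrier N"
    using G.generate_img[of ?SM] \<open>?SM \<subseteq> carrier M\<close> ss surj
    by (simp add: semisimple_module_def)
  moreover have "?gen \<subseteq> carrier N"
    using group.generate_incl[OF N.M.a_group, of ?SN] \<open>?SN \<subseteq> carrier N\<close> by simp
  ultimately show ?thesis by (auto simp: semisimple_module_def)
qed

lemma semisimple_submodule_image:
  assumes "semisimple_submodule K R M"
  shows "semisimple_submodule (f ` K) R N"
proof -
  have K: "submodule K R M" using assms by (simp add: semisimple_submodule_def)
  interpret res: right_module_homomorphism R "M\<lparr>carrier := K\<rparr>" "N\<lparr>carrier := f ` K\<rparr>" f
    using K submodule_image[OF K] by (rule restrict) simp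
  show ?thesis
    using res.semisimple_module_image assms submodule_image[OF K]
    by (simp add: semisimple_submodule_def)
qed

text \<open>The inverse isomorphism presents \<open>M\<close> as a homomorphic image of \<open>f ` carrier M\<close>.\<close>

lemma semisimple_module_if_inj_image:
  assumes inj: "inj_on f (carrier M)" and ss: "semisimple_submodule (f ` carrier M) R N"
  shows "semisimple_module R M"
proof -
  let ?g = "inv_into (carrier M) f" and ?I = "N\<lparr>carrier := f ` carrier M\<rparr>"
  have inv: "?g (f x) = x" if "x \<in> carrier M" for x using inj that by simp
  have "?g (f x \<oplus>\<^bsub>N\<^esub> f y) = x \<oplus>\<^bsub>M\<^esub> y" if "x \<in> carrier M" "y \<in> carrier M" for x y
    using that inv[of "x \<oplus>\<^bsub>M\<^esub> y"] by (simp add: add)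
  moreover have "?g (a \<odot>\<^bsub>N\<^esub> f x) = a \<odot>\<^bsub>M\<^esub> x" if "a \<in> carrier R" "x \<in> carrier M" for a x
    using that inv[of "a \<odot>\<^bsub>M\<^esub> x"] by (simp add: smult M.smult_closed)
  ultimately have "?g \<in> right_module_hom R ?I M"
    by (auto simp: right_module_hom_def hom_def inv)
  then interpret inverse: right_module_homomorphism R ?I M ?g
    using ss by (simp add: right_module_homomorphism_def right_module_homomorphism_axioms_def
        semisimple_submodule_def N.submodule_is_right_module M.right_module_axioms)
  have "?g ` carrier ?I = carrier M" by (auto simp: inv image_image)
  then show ?thesis
    using ss by (intro inverse.semisimple_module_image) (simp_all add: semisimple_submodule_def)
qed

text \<open>
  If \<open>f ` A\<close> and \<open>L\<close> together span \<open>N\<close>, then \<open>A\<close> and the preimage of \<open>L\<close> span \<open>M\<close>: an equation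
  \<open>f x = f a + l\<close> puts \<open>x - a\<close> into the preimage.  Smallness of \<open>A\<close> makes the preimage all of \<open>M\<close>,
  and then \<open>L = N\<close> by surjectivity.
\<close>

lemma small_submodule_image:
  assumes surj: "f ` carrier M = carrier N" and small: "small_submodule A R M"
  shows "small_submodule (f ` A) R N"
proof -
  have A: "submodule A R M" using small by (simp add: small_submodule_def)
  have "L = carrier N" if L: "submodule L R N" and sum: "f ` A <+>\<^bsub>N\<^esub> L = carrier N" for L
  proof -
    let ?P = "{x \<in> carrier M. f x \<in> L}"
    have P: "submodule ?P R M" using M.carrier_is_submodule L by (rule submodule_vimage)
    have AM: "A \<subseteq> carrier M" using A by (simp add: M.submodule_iff)
    have "x \<in> A <+>\<^bsub>M\<^esub> ?P" if x: "x \<in> carrier M" for x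
    proof -
      have "f x \<in> f ` A <+>\<^bsub>N\<^esub> L" using sum closed[OF x] by simp
      then obtain a l where a: "a \<in> A" and l: "l \<in> L" and fx: "f x = f a \<oplus>\<^bsub>N\<^esub> l"
        by (auto simp: set_add_def')
      have aM: "a \<in> carrier M" using a AM by auto
      have lN: "l \<in> carrier N" using l L by (auto simp: N.submodule_iff)
      let ?d = "\<ominus>\<^bsub>M\<^esub> a \<oplus>\<^bsub>M\<^esub> x"
      have "x = a \<oplus>\<^bsub>M\<^esub> ?d" using x aM by (simp add: M.M.r_neg2)
      then have "f a \<oplus>\<^bsub>N\<^esub> f ?d = f a \<oplus>\<^bsub>N\<^esub> l"
        using add[of a ?d] fx x aM by simp
      then have "f ?d = l"
        using x aM lN closed by (simp add: N.M.add.l_cancel del: N.M.add.right_cancel)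
      then have "?d \<in> ?P" using x aM l by simp
      then show ?thesis using a \<open>x = a \<oplus>\<^bsub>M\<^esub> ?d\<close> by (auto simp: set_add_def')
    qed
    moreover have "A <+>\<^bsub>M\<^esub> ?P \<subseteq> carrier M" using AM by (auto simp: set_add_def')
    ultimately have "?P = carrier M"
      using small P unfolding small_submodule_def by blast
    then have "f ` carrier M \<subseteq> L" by blast
    then show ?thesis using surj L by (simp add: N.submodule_iff)
  qed
  then show ?thesis using submodule_image[OF A] by (auto simp: small_submodule_def)
qed

lemma comp_hom:
  assumes "g \<in> right_module_hom R N P"
  shows "g \<circ> f \<in> right_module_hom R M P"
  using assms closed add smult by (auto simp: right_module_hom_def hom_def)

end

section \<open>Quotient modules on a set of representatives\<close>

text \<open>
  The carrier of the factor module \<open>N / K\<close> consists of sets of elements of \<open>N\<close> and so lies in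
  another type.  Since test modules must stay within one type, the factor module is modelled on
  a set of coset representatives: \<open>r\<close> is the map that replaces an element by its representative.
\<close>

definition representative_module :: "('b \<Rightarrow> 'b) \<Rightarrow> ('a, 'b) module \<Rightarrow> ('a, 'b) module" where
  "representative_module r N =
    N\<lparr>carrier := r ` carrier N, zero := r \<zero>\<^bsub>N\<^esub>, add := (\<lambda>x y. r (x \<oplus>\<^bsub>N\<^esub> y)),
      smult := (\<lambda>a x. r (a \<odot>\<^bsub>N\<^esub> x))\<rparr>"

definition coset_rep :: "('a, 'b, 'n) module_scheme \<Rightarrow> 'b set \<Rightarrow> 'b \<Rightarrow> 'b" where
  "coset_rep N K x = (SOME y. y \<in> K +>\<^bsub>N\<^esub> x)"

text \<open>
  The two congruence conditions make \<open>r\<close> commute with the operations up to a final application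
  of \<open>r\<close>; each module axiom then results from applying \<open>r\<close> to the same axiom of \<open>N\<close>.
\<close>

lemma representative_module_hom:
  fixes N :: "('a, 'b) module"
  assumes N: "right_module R N"
    and closed: "\<And>x. x \<in> carrier N \<Longrightarrow> r x \<in> carrier N"
    and add: "\<And>x y. x \<in> carrier N \<Longrightarrow> y \<in> carrier N \<Longrightarrow> r (r x \<oplus>\<^bsub>N\<^esub> y) = r (x \<oplus>\<^bsub>N\<^esub> y)"
    and smult: "\<And>a x. a \<in> carrier R \<Longrightarrow> x \<in> carrier N \<Longrightarrow> r (a \<odot>\<^bsub>N\<^esub> r x) = r (a \<odot>\<^bsub>N\<^esub> x)"
  shows "right_module_homomorphism R N (representative_module r N) r"
proof -
  interpret N: right_module R N by (rule N)
  let ?Q = "representative_module r N"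
  have add': "r (x \<oplus>\<^bsub>N\<^esub> r y) = r (x \<oplus>\<^bsub>N\<^esub> y)" if "x \<in> carrier N" "y \<in> carrier N" for x y
    using that add[of y x] closed by (simp add: N.M.a_comm)
  have idem: "r (r x) = r x" if "x \<in> carrier N" for x
    using that add[of x "\<zero>\<^bsub>N\<^esub>"] closed by simp
  note congr = closed add add' smult idem
  have "abelian_group ?Q"
    unfolding representative_module_def
  proof (rule abelian_groupI, goal_cases)
    case (4 x y)
    then show ?case by (auto simp: congr N.M.a_comm)
  next
    case (6 x)
    then obtain u where u: "u \<in> carrier N" "x = r u" by auto
    then have "r (r (\<ominus>\<^bsub>N\<^esub> u) \<oplus>\<^bsub>N\<^esub> x) = r \<zero>\<^bsub>N\<^esub>" by (simp add: congr N.M.l_neg)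
    then show ?case using u by (intro bexI[of _ "r (\<ominus>\<^bsub>N\<^esub> u)"]) auto
  qed (auto simp: congr N.M.a_assoc)
  moreover have "right_module_axioms R ?Q"
  proof -
    (* Two applications of the action separate the inner r x from the outer r, so the ring
       operation is carried out first. *)
    have "r (a \<odot>\<^bsub>N\<^esub> r x \<oplus>\<^bsub>N\<^esub> b \<odot>\<^bsub>N\<^esub> r x) = r (a \<odot>\<^bsub>N\<^esub> x \<oplus>\<^bsub>N\<^esub> b \<odot>\<^bsub>N\<^esub> x)"
      and "r (b \<odot>\<^bsub>N\<^esub> (a \<odot>\<^bsub>N\<^esub> r x)) = r (b \<odot>\<^bsub>N\<^esub> (a \<odot>\<^bsub>N\<^esub> x))"
      if "a \<in> carrier R" "b \<in> carrier R" "x \<in> carrier N" for a b x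
      using that smult[of "a \<oplus>\<^bsub>R\<^esub> b" x] smult[of "a \<otimes>\<^bsub>R\<^esub> b" x] closed
      by (simp_all add: N.smult_l_distr N.smult_assoc)
    then show ?thesis
      by (auto simp: representative_module_def right_module_axioms_def congr N.smult_closed
          N.smult_l_distr N.smult_r_distr N.smult_assoc N.smult_one)
  qed
  ultimately have "right_module R ?Q" by (simp add: right_module_def N.R.ring_axioms)
  moreover have "r \<in> right_module_hom R N ?Q"
    by (auto simp: right_module_hom_def hom_def representative_module_def congr N.smult_closed)
  ultimately show ?thesis
    by (simp add: right_module_homomorphism_def right_module_homomorphism_axioms_def N)
qed

lemma (in right_module) coset_rep_eq:
  assumes K: "submodule K R M" and x: "x \<in> carrier M"
  obtains k where "k \<in> K" "coset_rep M K x = k \<oplus>\<^bsub>M\<^esub> x"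
proof -
  have "\<zero>\<^bsub>M\<^esub> \<oplus>\<^bsub>M\<^esub> x \<in> K +>\<^bsub>M\<^esub> x"
    using K by (auto simp: a_r_coset_def' submodule_iff simp del: M.l_zero)
  then have "coset_rep M K x \<in> K +>\<^bsub>M\<^esub> x" unfolding coset_rep_def by (rule someI)
  then show thesis using that by (auto simp: a_r_coset_def')
qed

lemma (in right_module) coset_rep_add:
  assumes K: "submodule K R M" and x: "x \<in> carrier M" and k: "k \<in> K"
  shows "coset_rep M K (k \<oplus>\<^bsub>M\<^esub> x) = coset_rep M K x"
proof -
  have "k \<oplus>\<^bsub>M\<^esub> x \<in> K +>\<^bsub>M\<^esub> x" using k by (auto simp: a_r_coset_def')
  then have "K +>\<^bsub>M\<^esub> x = K +>\<^bsub>M\<^esub> (k \<oplus>\<^bsub>M\<^esub> x)"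
    using M.a_repr_independence x submodule.axioms(1)[OF K] by blast
  then show ?thesis by (simp add: coset_rep_def)
qed

lemma coset_rep_hom:
  fixes N :: "('a, 'b) module"
  assumes N: "right_module R N" and K: "submodule K R N"
  shows "right_module_homomorphism R N (representative_module (coset_rep N K) N) (coset_rep N K)"
proof (rule representative_module_hom[OF N])
  interpret N: right_module R N by (rule N)
  have KN: "K \<subseteq> carrier N" using K by (simp add: N.submodule_iff)
  show "coset_rep N K x \<in> carrier N" if "x \<in> carrier N" for x
    using N.coset_rep_eq[OF K that] KN that by (metis N.M.a_closed subsetD)
  show "coset_rep N K (coset_rep N K x \<oplus>\<^bsub>N\<^esub> y) = coset_rep N K (x \<oplus>\<^bsub>N\<^esub> y)"
    if "x \<in> carrier N" "y \<in> carrier N" for x y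
  proof -
    obtain k where "k \<in> K" "coset_rep N K x = k \<oplus>\<^bsub>N\<^esub> x"
      using N.coset_rep_eq[OF K] \<open>x \<in> carrier N\<close> by blast
    then show ?thesis
      using that KN N.coset_rep_add[OF K, of "x \<oplus>\<^bsub>N\<^esub> y" k] by (auto simp: N.M.a_assoc)
  qed
  show "coset_rep N K (a \<odot>\<^bsub>N\<^esub> coset_rep N K x) = coset_rep N K (a \<odot>\<^bsub>N\<^esub> x)"
    if "a \<in> carrier R" "x \<in> carrier N" for a x
  proof -
    obtain k where k: "k \<in> K" "coset_rep N K x = k \<oplus>\<^bsub>N\<^esub> x"
      using N.coset_rep_eq[OF K] \<open>x \<in> carrier N\<close> by blast
    then have "a \<odot>\<^bsub>N\<^esub> k \<in> K" using K that by (simp add: N.submodule_iff)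
    then show ?thesis
      using that k KN N.coset_rep_add[OF K, of "a \<odot>\<^bsub>N\<^esub> x" "a \<odot>\<^bsub>N\<^esub> k"]
      by (auto simp: N.smult_r_distr N.smult_closed)
  qed
qed

section \<open>The equivalence\<close>

text \<open>
  The kernel of \<open>\<alpha>\<close> is divided out.  A representative of an element of \<open>A\<close> lies in \<open>A\<close> again and
  has the same value under \<open>\<alpha>\<close>, so the map induced by \<open>\<alpha>\<close> on the quotient is \<open>\<alpha>\<close> itself; it is
  injective there, which makes the image of \<open>A\<close> semisimple.
\<close>

lemma strongly_ss_injective_extends:
  fixes R :: "('a, 'r) ring_scheme" and M :: "('a, 'b, 'm) module_scheme"
    and N :: "('a, 'c) module"
  assumes M: "right_module R M" and inj: "strongly_ss_injective TYPE('c) R M"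
    and N: "right_module R N" and small: "small_submodule A R N"
    and \<alpha>: "\<alpha> \<in> right_module_hom R (N\<lparr>carrier := A\<rparr>) M"
    and ss: "semisimple_submodule (\<alpha> ` A) R M"
  shows "extends_to_hom R N M A \<alpha>"
proof -
  interpret M: right_module R M by (rule M)
  interpret N: right_module R N by (rule N)
  have A: "submodule A R N" using small by (simp add: small_submodule_def)
  interpret \<alpha>: right_module_homomorphism R "N\<lparr>carrier := A\<rparr>" M \<alpha>
    using \<alpha> by (simp add: right_module_homomorphism_def right_module_homomorphism_axioms_def
        N.submodule_is_right_module[OF A] M)
  have AN: "A \<subseteq> carrier N" using A by (simp add: N.submodule_iff)
  define K where "K = {x \<in> A. \<alpha> x = \<zero>\<^bsub>M\<^esub>}"
  have "submodule K R (N\<lparr>carrier := A\<rparr>)"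
    using \<alpha>.submodule_vimage[OF \<alpha>.M.carrier_is_submodule M.zero_is_submodule]
    by (simp add: K_def)
  then have K: "submodule K R N" by (simp add: N.submodule_of_submodule_iff[OF A])
  define r where "r = coset_rep N K"
  define Q where "Q = representative_module r N"
  interpret r: right_module_homomorphism R N Q r
    unfolding Q_def r_def using N K by (rule coset_rep_hom)
  have surj: "r ` carrier N = carrier Q" by (simp add: Q_def representative_module_def)
  have rA: "r x \<in> A" and \<alpha>r: "\<alpha> (r x) = \<alpha> x" if x: "x \<in> A" for x
  proof -
    obtain k where k: "k \<in> K" "r x = k \<oplus>\<^bsub>N\<^esub> x"
      unfolding r_def using N.coset_rep_eq[OF K subsetD[OF AN x]] by blast
    then have "k \<in> A" "\<alpha> k = \<zero>\<^bsub>M\<^esub>" by (auto simp: K_def)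
    then show "r x \<in> A" using x k A by (simp add: N.submodule_iff)
    show "\<alpha> (r x) = \<alpha> x"
      using k \<open>k \<in> A\<close> \<open>\<alpha> k = \<zero>\<^bsub>M\<^esub>\<close> x \<alpha>.add[of k x] \<alpha>.closed[of x] by simp
  qed
  have r_eqI: "r x = r y" if x: "x \<in> A" and y: "y \<in> A" and eq: "\<alpha> x = \<alpha> y" for x y
  proof -
    have xN: "x \<in> carrier N" and yN: "y \<in> carrier N" using x y AN by auto
    let ?k = "x \<oplus>\<^bsub>N\<^esub> \<ominus>\<^bsub>N\<^esub> y"
    have minus: "\<ominus>\<^bsub>N\<^esub> y \<in> A"
      using A y yN N.minus_eq_smult by (simp add: N.submodule_iff)
    have "?k \<in> A" using A x minus by (simp add: N.submodule_iff)
    have xk: "x = ?k \<oplus>\<^bsub>N\<^esub> y" using xN yN by (simp add: N.M.a_assoc N.M.l_neg)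
    then have "\<alpha> ?k \<oplus>\<^bsub>M\<^esub> \<alpha> y = \<alpha> y"
      using \<alpha>.add[of ?k y] \<open>?k \<in> A\<close> y eq by simp
    then have "\<alpha> ?k = \<zero>\<^bsub>M\<^esub>"
      using \<alpha>.closed[of y] \<alpha>.closed[of ?k] y \<open>?k \<in> A\<close> by (simp add: M.M.add.r_cancel_one)
    then have "?k \<in> K" using \<open>?k \<in> A\<close> by (simp add: K_def)
    then show ?thesis using N.coset_rep_add[OF K yN] xk by (metis r_def)
  qed
  have rA_sub: "submodule (r ` A) R Q" using A by (rule r.submodule_image)
  have \<alpha>_hom: "\<alpha> \<in> right_module_hom R (Q\<lparr>carrier := r ` A\<rparr>) M"
  proof -
    have add: "\<alpha> (r x \<oplus>\<^bsub>Q\<^esub> r y) = \<alpha> (r x) \<oplus>\<^bsub>M\<^esub> \<alpha> (r y)" if "x \<in> A" "y \<in> A" for x y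
    proof -
      have "r x \<oplus>\<^bsub>Q\<^esub> r y = r (x \<oplus>\<^bsub>N\<^esub> y)" "x \<oplus>\<^bsub>N\<^esub> y \<in> A"
        using that subsetD[OF AN] A r.add[of x y] by (auto simp: N.submodule_iff)
      then show ?thesis using that \<alpha>.add[of x y] by (simp add: \<alpha>r)
    qed
    have smult: "\<alpha> (a \<odot>\<^bsub>Q\<^esub> r x) = a \<odot>\<^bsub>M\<^esub> \<alpha> (r x)" if "a \<in> carrier R" "x \<in> A" for a x
    proof -
      have "a \<odot>\<^bsub>Q\<^esub> r x = r (a \<odot>\<^bsub>N\<^esub> x)" "a \<odot>\<^bsub>N\<^esub> x \<in> A"
        using that subsetD[OF AN] A r.smult[of a x] by (auto simp: N.submodule_iff)
      then show ?thesis using that \<alpha>.smult[of a x] by (simp add: \<alpha>r)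
    qed
    show ?thesis
      using add smult \<alpha>.closed by (auto simp: right_module_hom_def hom_def \<alpha>r)
  qed
  interpret \<alpha>Q: right_module_homomorphism R "Q\<lparr>carrier := r ` A\<rparr>" M \<alpha>
    using \<alpha>_hom by (simp add: right_module_homomorphism_def right_module_homomorphism_axioms_def
        r.N.submodule_is_right_module[OF rA_sub] M)
  have "inj_on \<alpha> (r ` A)"
  proof (rule inj_onI; clarify)
    fix x y assume "x \<in> A" "y \<in> A" "\<alpha> (r x) = \<alpha> (r y)"
    then show "r x = r y" by (intro r_eqI) (simp_all add: \<alpha>r)
  qed
  moreover have "\<alpha> ` r ` A = \<alpha> ` A" by (simp add: image_image \<alpha>r)
  ultimately have "semisimple_submodule (r ` A) R Q"
    using \<alpha>Q.semisimple_module_if_inj_image ss rA_sub by (simp add: semisimple_submodule_def)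
  moreover have "small_submodule (r ` A) R Q" using surj small by (rule r.small_submodule_image)
  ultimately have "extends_to_hom R Q M (r ` A) \<alpha>"
    using inj \<alpha>_hom r.N.right_module_axioms unfolding strongly_ss_injective_def by blast
  then obtain g where g: "g \<in> right_module_hom R Q M" "\<And>x. x \<in> A \<Longrightarrow> g (r x) = \<alpha> (r x)"
    by (auto simp: extends_to_hom_def)
  have "g \<circ> r \<in> right_module_hom R N M" using g(1) by (rule r.comp_hom)
  moreover have "\<forall>x\<in>A. (g \<circ> r) x = \<alpha> x" by (simp add: g(2) \<alpha>r)
  ultimately show ?thesis unfolding extends_to_hom_def by blast
qed

theorem proposition3p1:
  fixes R :: "('a, 'r) ring_scheme" and M :: "('a, 'b, 'm) module_scheme"
  assumes "ring R" and "right_module R M"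
  shows "strongly_ss_injective TYPE('c) R M \<longleftrightarrow>
    (\<forall>(N :: ('a, 'c) module) A \<alpha>.
      right_module R N \<and> small_submodule A R N \<and>
      \<alpha> \<in> right_module_hom R (N\<lparr>carrier := A\<rparr>) M \<and>
      semisimple_submodule (\<alpha> ` A) R M
      \<longrightarrow> extends_to_hom R N M A \<alpha>)"
    (is "_ \<longleftrightarrow> ?extension")
proof
  assume "strongly_ss_injective TYPE('c) R M"
  then show ?extension using strongly_ss_injective_extends[OF assms(2)] by blast
next
  assume ext: ?extension
  have "semisimple_submodule (f ` K) R M"
    if N: "right_module R N" and K: "semisimple_submodule K R N"
      and f: "f \<in> right_module_hom R (N\<lparr>carrier := K\<rparr>) M"
    for N :: "('a, 'c) module" and K f
  proof -
    have "right_module R (N\<lparr>carrier := K\<rparr>)"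
      using N K by (simp add: semisimple_submodule_def right_module.submodule_is_right_module)
    then interpret f: right_module_homomorphism R "N\<lparr>carrier := K\<rparr>" M f
      using f assms(2)
      by (simp add: right_module_homomorphism_def right_module_homomorphism_axioms_def)
    have "semisimple_submodule K R (N\<lparr>carrier := K\<rparr>)"
      using K f.M.carrier_is_submodule by (simp add: semisimple_submodule_def)
    then show ?thesis by (rule f.semisimple_submodule_image)
  qed
  then show "strongly_ss_injective TYPE('c) R M"
    using ext unfolding strongly_ss_injective_def by blast
qed

end
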